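(* Let $\beta>0$ and $0<k<\frac{3}{3+\beta}$. Let \[f_{+-}(x,y,z)=\beta(x^2y^2+y^2z^2+x^2z^2)+\Big(x^2+y^2+z^2-\tfrac12\Big)^2-\tfrac{1-k}{4}.\] Then the zero set $Q^{+-}(k)=\{(x,y,z)\in\mathbb{R}^3: f_{+-}(x,y,z)=0\}$ is the disjoint union of two embedded compact connected components, each invariant under the octahedral group $O_h$ and each homeomorphic to a sphere.
   Context: $O_h$ denotes the octahedral group of order 48, i.e. the group of all $3\times 3$ signed permutation matrices acting on $\mathbb{R}^3$; $f_{+-}$ is $O_h$-invariant. *)

theory Defs
  imports "HOL-Analysis.Analysis"
begin

definition f_pm :: "real \<Rightarrow> real \<Rightarrow> real^3 \<Rightarrow> real" where
  "f_pm \<beta> k v = (let x = v$1; y = v$2; z = v$3 in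
      \<beta> * (x^2 * y^2 + y^2 * z^2 + x^2 * z^2) + (x^2 + y^2 + z^2 - 1/2)^2 - (1 - k) / 4)"

definition Q_pm :: "real \<Rightarrow> real \<Rightarrow> (real^3) set" where
  "Q_pm \<beta> k = {v. f_pm \<beta> k v = 0}"

definition O_h :: "(real^3^3) set" where
  "O_h = {M. \<exists>p s. p permutes (UNIV :: 3 set) \<and> (\<forall>i. s i \<in> {-1, 1::real}) \<and>
                  M = (\<chi> i j. if j = p i then s i else 0)}"

end

theory Submission
  imports Defs "HOL-Library.Quadratic_Discriminant"
begin

text \<open>On the ray through a unit vector u, the value of f_{+-} at the point of squared norm \<rho> is
  the quadratic (1 + \<beta> \<sigma>(u)) \<rho>^2 - \<rho> + k/4, where \<sigma> (pair_sum) is the second elementary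
  symmetric function of the squared coordinates. Since \<sigma>(u) \<le> 1/3, the hypothesis on k puts the
  discriminant 1 - k(1 + \<beta> \<sigma>(u)) in (0,1), so every ray meets the zero set in exactly two
  points, at radii depending continuously on u. The zero set is thus the union of two disjoint
  radial graphs over the unit sphere, which are therefore its components; as O_h preserves both
  the norm and \<sigma>, it preserves each graph.\<close>

definition pair_sum :: "real^3 \<Rightarrow> real" where
  "pair_sum v = (v$1)^2 * (v$2)^2 + (v$2)^2 * (v$3)^2 + (v$1)^2 * (v$3)^2"

lemma norm_power2_eq_sum_vec: "(norm v)^2 = (\<Sum>i\<in>UNIV. (v$i)^2)"
  for v :: "real^'n"
  unfolding power2_norm_eq_inner inner_vec_def by (simp add: power2_eq_square)

lemma pair_sum_eq_power_sums:
  "pair_sum v = ((\<Sum>i\<in>UNIV. (v$i)^2)^2 - (\<Sum>i\<in>UNIV. ((v$i)^2)^2)) / 2"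
  unfolding pair_sum_def sum_3 by (simp add: power2_eq_square algebra_simps)

lemma f_pm_eq: "f_pm \<beta> k v = \<beta> * pair_sum v + ((norm v)^2)^2 - (norm v)^2 + k / 4"
  unfolding f_pm_def pair_sum_def norm_power2_eq_sum_vec sum_3 Let_def
  by (simp add: power2_eq_square field_simps)

lemma pair_sum_scaleR: "pair_sum (c *\<^sub>R v) = (c^2)^2 * pair_sum v"
  unfolding pair_sum_def by (simp add: power_mult_distrib algebra_simps)

lemma pair_sum_nonneg: "0 \<le> pair_sum v"
  unfolding pair_sum_def by simp

lemma pair_sum_le_norm: "3 * pair_sum v \<le> ((norm v)^2)^2"
proof -
  have "3 * (a*b + b*c + a*c) \<le> (a + b + c)^2" for a b c :: real
  proof -
    have "0 \<le> (a - b)^2 + (b - c)^2 + (a - c)^2" by simp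
    thus ?thesis by (simp add: power2_eq_square algebra_simps)
  qed
  thus ?thesis unfolding pair_sum_def norm_power2_eq_sum_vec sum_3 by simp
qed

lemma O_h_apply:
  assumes "M \<in> O_h"
  obtains p s where "p permutes (UNIV :: 3 set)" "\<And>i. s i \<in> {-1, 1 :: real}"
    "\<And>v i. (M *v v)$i = s i * v$(p i)"
proof -
  obtain p s where ps: "p permutes (UNIV :: 3 set)" "\<forall>i. s i \<in> {-1, 1 :: real}"
    "M = (\<chi> i j. if j = p i then s i else 0)"
    using assms unfolding O_h_def by blast
  have "(M *v v)$i = s i * v$(p i)" for v i
  proof -
    have "(if j = p i then s i else 0) * v$j = (if j = p i then s i * v$j else 0)" for j
      by simp
    then show ?thesis unfolding ps(3) matrix_vector_mult_def by (simp add: sum.delta')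
  qed
  with ps that show ?thesis by blast
qed

lemma sum_O_h_coordinates_squared:
  assumes "M \<in> O_h"
  shows "(\<Sum>i\<in>UNIV. h (((M *v v)$i)^2)) = (\<Sum>i\<in>UNIV. h ((v$i)^2))"
proof -
  obtain p s where p: "p permutes (UNIV :: 3 set)" and s: "\<And>i. s i \<in> {-1, 1 :: real}"
    and M: "\<And>v i. (M *v v)$i = s i * v$(p i)"
    using O_h_apply[OF assms] by metis
  have "((M *v v)$i)^2 = (v$(p i))^2" for i
    using s[of i] unfolding M by (auto simp: power_mult_distrib)
  then have "(\<Sum>i\<in>UNIV. h (((M *v v)$i)^2)) = (\<Sum>i\<in>UNIV. ((\<lambda>i. h ((v$i)^2)) \<circ> p) i)"
    by simp
  also have "\<dots> = (\<Sum>i\<in>UNIV. h ((v$i)^2))"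
    by (rule sum.permute[OF p, symmetric])
  finally show ?thesis .
qed

lemma norm_O_h: "M \<in> O_h \<Longrightarrow> norm (M *v v) = norm v"
  using sum_O_h_coordinates_squared[of M id v]
  by (simp flip: norm_power2_eq_sum_vec add: power2_eq_iff_nonneg)

lemma pair_sum_O_h: "M \<in> O_h \<Longrightarrow> pair_sum (M *v v) = pair_sum v"
  unfolding pair_sum_eq_power_sums
  using sum_O_h_coordinates_squared[of M id v] sum_O_h_coordinates_squared[of M "\<lambda>x. x^2" v]
  by simp

lemma O_h_image_sphere:
  assumes "M \<in> O_h"
  shows "(\<lambda>v. M *v v) ` sphere 0 1 = sphere 0 1"
proof -
  have "orthogonal_transformation (\<lambda>v. M *v v)"
    unfolding orthogonal_transformation
    by (simp add: matrix_vector_mul_linear norm_O_h[OF assms])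
  then have "surj (\<lambda>v. M *v v)" by (rule orthogonal_transformation_surj)
  show ?thesis
  proof
    show "(\<lambda>v. M *v v) ` sphere 0 1 \<subseteq> sphere 0 1"
      using norm_O_h[OF assms] by auto
    show "sphere 0 1 \<subseteq> (\<lambda>v. M *v v) ` sphere 0 1"
    proof
      fix w :: "real^3" assume "w \<in> sphere 0 1"
      moreover obtain v where "w = M *v v" using \<open>surj (\<lambda>v. M *v v)\<close> by blast
      ultimately show "w \<in> (\<lambda>v. M *v v) ` sphere 0 1"
        using norm_O_h[OF assms, of v] by auto
    qed
  qed
qed

lemma scaleR_unit_eq_iff:
  fixes u w :: "'a::real_normed_vector"
  assumes "norm u = 1" "norm w = 1" "0 < a" "0 < b"
  shows "a *\<^sub>R u = b *\<^sub>R w \<longleftrightarrow> a = b \<and> u = w"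
proof
  assume eq: "a *\<^sub>R u = b *\<^sub>R w"
  then have "norm (a *\<^sub>R u) = norm (b *\<^sub>R w)" by simp
  then have "a = b" using assms by simp
  with eq assms(3) show "a = b \<and> u = w" by simp
qed simp

lemma connected_component_Un_closed_disjoint:
  assumes "closed A" "closed B" "A \<inter> B = {}" "connected A" "a \<in> A"
  shows "connected_component_set (A \<union> B) a = A"
proof
  show "A \<subseteq> connected_component_set (A \<union> B) a"
    by (rule connected_component_maximal[OF assms(5,4)]) auto
  let ?C = "connected_component_set (A \<union> B) a"
  have "?C \<subseteq> A \<union> B" by (rule connected_component_subset)
  moreover have "a \<in> ?C" using assms(5) by simp
  ultimately have "A \<inter> ?C = {} \<or> B \<inter> ?C = {}"
    using assms(1-3) by (intro connected_closedD) auto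
  with \<open>a \<in> ?C\<close> \<open>?C \<subseteq> A \<union> B\<close> assms(5) show "?C \<subseteq> A" by blast
qed

locale Q_pm_params =
  fixes \<beta> k :: real
  assumes beta_pos: "0 < \<beta>" and k_pos: "0 < k" and k_less: "k < 3 / (3 + \<beta>)"
begin

definition ray_coeff :: "real^3 \<Rightarrow> real" where
  "ray_coeff u = 1 + \<beta> * pair_sum u"

text \<open>For s = 1 and s = -1 these are the two roots \<rho> of the quadratic along the ray through u,
  i.e. the squared radii of the outer and the inner component.\<close>

definition ray_root :: "real \<Rightarrow> real^3 \<Rightarrow> real" where
  "ray_root s u = (1 + s * sqrt (discrim (ray_coeff u) (-1) (k/4))) / (2 * ray_coeff u)"

definition shell :: "real \<Rightarrow> (real^3) set" where
  "shell s = (\<lambda>u. sqrt (ray_root s u) *\<^sub>R u) ` sphere 0 1"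

lemma ray_coeff_ge_1: "1 \<le> ray_coeff u"
  unfolding ray_coeff_def using beta_pos pair_sum_nonneg[of u] by simp

lemma f_pm_ray:
  assumes "norm u = 1"
  shows "f_pm \<beta> k (c *\<^sub>R u) = ray_coeff u * (c^2)^2 + (-1) * c^2 + k/4"
  unfolding f_pm_eq pair_sum_scaleR ray_coeff_def using assms by (simp add: algebra_simps)

lemma discrim_bounds:
  assumes "norm u = 1"
  shows "0 < discrim (ray_coeff u) (-1) (k/4)" "discrim (ray_coeff u) (-1) (k/4) < 1"
proof -
  have "3 * (k * ray_coeff u) = k * (3 + \<beta> * (3 * pair_sum u))"
    unfolding ray_coeff_def by (simp add: algebra_simps)
  also have "\<dots> \<le> k * (3 + \<beta>)"
    using pair_sum_le_norm[of u] assms beta_pos k_pos by (intro mult_left_mono) auto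
  also have "\<dots> < 3" using k_less beta_pos by (simp add: field_simps)
  finally have "k * ray_coeff u < 1" by simp
  moreover have "0 < k * ray_coeff u" using k_pos ray_coeff_ge_1[of u] by simp
  ultimately show "0 < discrim (ray_coeff u) (-1) (k/4)" "discrim (ray_coeff u) (-1) (k/4) < 1"
    unfolding discrim_def by (simp_all add: mult.commute)
qed

lemma ray_root_pos:
  assumes "norm u = 1" "s \<in> {-1, 1}"
  shows "0 < ray_root s u"
proof -
  define d where "d = sqrt (discrim (ray_coeff u) (-1) (k/4))"
  have "0 < d" "d < 1"
    unfolding d_def using discrim_bounds[OF assms(1)] by (simp_all add: real_sqrt_lt_1_iff)
  then have "0 < 1 + s * d" using assms(2) by auto
  then show ?thesis unfolding ray_root_def d_def[symmetric] using ray_coeff_ge_1[of u] by simp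
qed

lemma ray_in_Q_pm_iff:
  assumes "norm u = 1"
  shows "c *\<^sub>R u \<in> Q_pm \<beta> k \<longleftrightarrow> c^2 = ray_root 1 u \<or> c^2 = ray_root (-1) u"
proof -
  have "c *\<^sub>R u \<in> Q_pm \<beta> k \<longleftrightarrow> ray_coeff u * (c^2)^2 + (-1) * c^2 + k/4 = 0"
    by (simp add: Q_pm_def f_pm_ray[OF assms])
  also have "\<dots> \<longleftrightarrow> c^2 = (- (-1) + sqrt (discrim (ray_coeff u) (-1) (k/4))) / (2 * ray_coeff u) \<or>
                    c^2 = (- (-1) - sqrt (discrim (ray_coeff u) (-1) (k/4))) / (2 * ray_coeff u)"
    using ray_coeff_ge_1[of u] discrim_bounds(1)[OF assms] by (intro discriminant_nonneg) auto
  also have "\<dots> \<longleftrightarrow> c^2 = ray_root 1 u \<or> c^2 = ray_root (-1) u"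
    unfolding ray_root_def by simp
  finally show ?thesis .
qed

lemma continuous_on_ray_coeff: "continuous_on S ray_coeff"
  unfolding ray_coeff_def pair_sum_def by (intro continuous_intros)

lemma continuous_on_ray_root: "continuous_on S (ray_root s)"
proof -
  have "2 * ray_coeff u \<noteq> 0" for u using ray_coeff_ge_1[of u] by linarith
  then show ?thesis
    unfolding ray_root_def discrim_def by (intro continuous_intros continuous_on_ray_coeff) simp
qed

lemma sqrt_ray_root_scaleR_in_Q_pm:
  assumes "norm u = 1" "s \<in> {-1, 1}"
  shows "sqrt (ray_root s u) *\<^sub>R u \<in> Q_pm \<beta> k"
  using ray_in_Q_pm_iff[OF assms(1)] ray_root_pos[OF assms] assms(2) by auto

lemma Q_pm_eq_shells: "Q_pm \<beta> k = shell 1 \<union> shell (-1)"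
proof
  show "shell 1 \<union> shell (-1) \<subseteq> Q_pm \<beta> k"
    unfolding shell_def using sqrt_ray_root_scaleR_in_Q_pm by auto
  show "Q_pm \<beta> k \<subseteq> shell 1 \<union> shell (-1)"
  proof
    fix v assume v: "v \<in> Q_pm \<beta> k"
    have "v \<noteq> 0"
      using v k_pos unfolding Q_pm_def f_pm_eq by (auto simp: pair_sum_def)
    define u where "u = (1 / norm v) *\<^sub>R v"
    have u: "norm u = 1" "v = norm v *\<^sub>R u"
      unfolding u_def using \<open>v \<noteq> 0\<close> by simp_all
    then obtain s where s: "s \<in> {-1, 1}" "(norm v)^2 = ray_root s u"
      using v ray_in_Q_pm_iff[of u "norm v"] by auto
    then have "norm v = sqrt (ray_root s u)" by (simp add: real_sqrt_unique)
    with u s(1) show "v \<in> shell 1 \<union> shell (-1)"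
      unfolding shell_def by auto
  qed
qed

lemma shells_disjoint: "shell 1 \<inter> shell (-1) = {}"
proof -
  have "sqrt (ray_root 1 u) *\<^sub>R u \<noteq> sqrt (ray_root (-1) w) *\<^sub>R w"
    if "norm u = 1" "norm w = 1" for u w
  proof
    assume "sqrt (ray_root 1 u) *\<^sub>R u = sqrt (ray_root (-1) w) *\<^sub>R w"
    then have "ray_root 1 u = ray_root (-1) u"
      using scaleR_unit_eq_iff that ray_root_pos[OF that(1)] ray_root_pos[OF that(2)] by force
    then have "sqrt (discrim (ray_coeff u) (-1) (k/4)) = 0"
      unfolding ray_root_def using ray_coeff_ge_1[of u] by (simp add: field_simps)
    then show False using discrim_bounds[OF that(1)] by simp
  qed
  then show ?thesis unfolding shell_def by auto
qed

lemma shell_homeomorphic_sphere: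
  assumes "s \<in> {-1, 1}"
  shows "shell s homeomorphic sphere (0 :: real^3) 1"
proof (rule homeomorphic_sym[THEN iffD1], rule homeomorphic_compact)
  show "continuous_on (sphere 0 1) (\<lambda>u. sqrt (ray_root s u) *\<^sub>R u)"
    by (intro continuous_intros continuous_on_ray_root)
  show "inj_on (\<lambda>u. sqrt (ray_root s u) *\<^sub>R u) (sphere 0 1)"
  proof (rule inj_onI)
    fix u w :: "real^3"
    assume "u \<in> sphere 0 1" "w \<in> sphere 0 1"
      and eq: "sqrt (ray_root s u) *\<^sub>R u = sqrt (ray_root s w) *\<^sub>R w"
    then have "norm u = 1" "norm w = 1" by auto
    moreover have "0 < sqrt (ray_root s u)" "0 < sqrt (ray_root s w)"
      using ray_root_pos assms calculation by auto
    ultimately show "u = w" using eq scaleR_unit_eq_iff by blast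
  qed
qed (simp_all add: shell_def)

lemma shell_nonempty: "shell s \<noteq> {}"
  unfolding shell_def by simp

lemma shell_O_h:
  assumes "M \<in> O_h"
  shows "(\<lambda>v. M *v v) ` shell s = shell s"
proof -
  have "ray_root s (M *v u) = ray_root s u" for u
    unfolding ray_root_def ray_coeff_def pair_sum_O_h[OF assms] ..
  then have "(\<lambda>v. M *v v) ` shell s = (\<lambda>u. sqrt (ray_root s u) *\<^sub>R u) ` (\<lambda>v. M *v v) ` sphere 0 1"
    unfolding shell_def image_image by (simp add: matrix_vector_mult_scaleR)
  then show ?thesis unfolding O_h_image_sphere[OF assms] shell_def .
qed

end

theorem lemma3:
  fixes \<beta> k :: real
  assumes "\<beta> > 0" and "0 < k" and "k < 3 / (3 + \<beta>)"
  shows "\<exists>A B. Q_pm \<beta> k = A \<union> B \<and> A \<inter> B = {} \<and>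
           (\<exists>a \<in> Q_pm \<beta> k. A = connected_component_set (Q_pm \<beta> k) a) \<and>
           (\<exists>b \<in> Q_pm \<beta> k. B = connected_component_set (Q_pm \<beta> k) b) \<and>
           compact A \<and> compact B \<and> connected A \<and> connected B \<and>
           (\<forall>M \<in> O_h. (\<lambda>v. M *v v) ` A = A \<and> (\<lambda>v. M *v v) ` B = B) \<and>
           A homeomorphic (sphere (0 :: real^3) 1) \<and>
           B homeomorphic (sphere (0 :: real^3) 1)"
proof -
  interpret Q_pm_params \<beta> k using assms by unfold_locales
  let ?A = "shell 1" and ?B = "shell (-1)"
  have homeo: "?A homeomorphic sphere (0 :: real^3) 1" "?B homeomorphic sphere (0 :: real^3) 1"
    using shell_homeomorphic_sphere by auto
  then have compact: "compact ?A" "compact ?B" and connected: "connected ?A" "connected ?B"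
    using homeomorphic_compactness[OF homeo(1)] homeomorphic_compactness[OF homeo(2)]
      homeomorphic_connectedness[OF homeo(1)] homeomorphic_connectedness[OF homeo(2)]
    by (simp_all add: connected_sphere)
  obtain a b where "a \<in> ?A" "b \<in> ?B" using shell_nonempty by blast
  then have "?A = connected_component_set (?A \<union> ?B) a"
    "?B = connected_component_set (?B \<union> ?A) b"
    using connected_component_Un_closed_disjoint compact[THEN compact_imp_closed] connected
      shells_disjoint by (metis Int_commute)+
  with \<open>a \<in> ?A\<close> \<open>b \<in> ?B\<close> show ?thesis
    using Q_pm_eq_shells shells_disjoint compact connected shell_O_h homeo
    by (intro exI[of _ ?A] exI[of _ ?B]) (auto simp: Un_commute)
qed

end
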